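(* Let $L$ be the free commutative Moufang loop of exponent $3$ on the seven free generators $x,y,z,t,v,w,a$. Then $$((((x,y,a),a,z),t,v),a,w)\neq 1$$ in $L$. Consequently the Triple Argument Hypothesis fails for $n\ge 7$: $TAH(L_n)\neq(1)$ for all $n\geq 7$.
   Context: A commutative Moufang loop (CML) is a loop satisfying $xy=yx$ and $(xy)(zx)=((xy)z)x$; it has exponent $3$ if $x^3=1$ for all $x$. $L_n$ is the free CML of exponent $3$ on $n$ generators. The associator is $(x,y,z)=((xy)z)(x(yz))^{-1}$. $TAH(L_n)$ is the normal subloop of $L_n$ generated by all (iterated) associators in $L_n$ in which some argument appears three times; the Triple Argument Hypothesis for $n$ is the assertion that $TAH(L_n)=(1)$.
   Formalization: The Moufang identity is taken in its standard form (xy)(zx)=(x(yz))x; the printed form (xy)(zx)=((xy)z)x would, with u=xy arbitrary, force associativity, making every associator trivial and the claim false. *)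

theory Defs
  imports "HOL-Algebra.Coset"
begin

section \<open>Commutative Moufang loops\<close>

locale loop =
  fixes L (structure)
  assumes m_closed [intro, simp]: "\<lbrakk>x \<in> carrier L; y \<in> carrier L\<rbrakk> \<Longrightarrow> x \<otimes> y \<in> carrier L"
    and one_closed [intro, simp]: "\<one> \<in> carrier L"
    and l_one [simp]: "x \<in> carrier L \<Longrightarrow> \<one> \<otimes> x = x"
    and r_one [simp]: "x \<in> carrier L \<Longrightarrow> x \<otimes> \<one> = x"
    and l_solve: "\<lbrakk>a \<in> carrier L; b \<in> carrier L\<rbrakk> \<Longrightarrow> \<exists>!x. x \<in> carrier L \<and> a \<otimes> x = b"
    and r_solve: "\<lbrakk>a \<in> carrier L; b \<in> carrier L\<rbrakk> \<Longrightarrow> \<exists>!x. x \<in> carrier L \<and> x \<otimes> a = b"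

text \<open>
  The Moufang identity is the usual one, with the product of \<open>y\<close> and \<open>z\<close> in the middle.
  The identity \<open>(x y)(z x) = ((x y) z) x\<close> would force associativity in every loop.
\<close>

locale comm_moufang_loop = loop +
  assumes m_comm: "\<lbrakk>x \<in> carrier L; y \<in> carrier L\<rbrakk> \<Longrightarrow> x \<otimes> y = y \<otimes> x"
    and moufang: "\<lbrakk>x \<in> carrier L; y \<in> carrier L; z \<in> carrier L\<rbrakk>
      \<Longrightarrow> (x \<otimes> y) \<otimes> (z \<otimes> x) = (x \<otimes> (y \<otimes> z)) \<otimes> x"

locale comm_moufang_loop_exp3 = comm_moufang_loop +
  assumes exp3: "x \<in> carrier L \<Longrightarrow> x [^] (3::nat) = \<one>"

definition associator :: "('a, 'b) monoid_scheme \<Rightarrow> 'a \<Rightarrow> 'a \<Rightarrow> 'a \<Rightarrow> 'a" where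
  "associator L x y z =
     ((x \<otimes>\<^bsub>L\<^esub> y) \<otimes>\<^bsub>L\<^esub> z) \<otimes>\<^bsub>L\<^esub> inv\<^bsub>L\<^esub> (x \<otimes>\<^bsub>L\<^esub> (y \<otimes>\<^bsub>L\<^esub> z))"

definition subloop :: "'a set \<Rightarrow> ('a, 'b) monoid_scheme \<Rightarrow> bool" where
  "subloop H L \<longleftrightarrow> H \<subseteq> carrier L \<and> loop (L\<lparr>carrier := H\<rparr>)"

definition normal_subloop :: "'a set \<Rightarrow> ('a, 'b) monoid_scheme \<Rightarrow> bool" where
  "normal_subloop H L \<longleftrightarrow> subloop H L \<and>
     (\<forall>x\<in>carrier L. x <#\<^bsub>L\<^esub> H = H #>\<^bsub>L\<^esub> x) \<and>
     (\<forall>x\<in>carrier L. \<forall>y\<in>carrier L.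
        x <#\<^bsub>L\<^esub> (y <#\<^bsub>L\<^esub> H) = (x \<otimes>\<^bsub>L\<^esub> y) <#\<^bsub>L\<^esub> H \<and>
        (H #>\<^bsub>L\<^esub> x) #>\<^bsub>L\<^esub> y = H #>\<^bsub>L\<^esub> (x \<otimes>\<^bsub>L\<^esub> y))"

definition normal_closure :: "('a, 'b) monoid_scheme \<Rightarrow> 'a set \<Rightarrow> 'a set" where
  "normal_closure L A = \<Inter>{N. normal_subloop N L \<and> A \<subseteq> N}"


section \<open>Iterated associators and the subloop \<open>TAH(L)\<close>\<close>

datatype 'a assoc_word = Arg 'a | Assoc "'a assoc_word" "'a assoc_word" "'a assoc_word"

primrec args :: "'a assoc_word \<Rightarrow> 'a list" where
  "args (Arg a) = [a]"
| "args (Assoc p q r) = args p @ args q @ args r"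

primrec assoc_value :: "('a, 'b) monoid_scheme \<Rightarrow> 'a assoc_word \<Rightarrow> 'a" where
  "assoc_value L (Arg a) = a"
| "assoc_value L (Assoc p q r) =
     associator L (assoc_value L p) (assoc_value L q) (assoc_value L r)"

text \<open>
  The arguments are arbitrary elements of \<open>L\<close> and associators may be nested in any position.
  The condition on \<open>count_list\<close> excludes the degenerate words \<open>Arg a\<close>.
\<close>

definition triple_argument_associators :: "('a, 'b) monoid_scheme \<Rightarrow> 'a set" where
  "triple_argument_associators L =
     {assoc_value L p | p. set (args p) \<subseteq> carrier L \<and> (\<exists>a. count_list (args p) a \<ge> 3)}"

definition TAH :: "('a, 'b) monoid_scheme \<Rightarrow> 'a set" where
  "TAH L = normal_closure L (triple_argument_associators L)"


section \<open>Free commutative Moufang loops of exponent 3\<close>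

datatype 'g loop_term =
    Gen 'g
  | Unit
  | Mul "'g loop_term" "'g loop_term"
  | LDiv "'g loop_term" "'g loop_term"
  | RDiv "'g loop_term" "'g loop_term"

text \<open>
  Equational consequence of the identities of commutative Moufang loops of exponent 3, with loops
  regarded as algebras with multiplication, unit and the divisions
  \<open>LDiv s t\<close> (the solution \<open>x\<close> of \<open>s x = t\<close>) and \<open>RDiv t s\<close> (the solution \<open>x\<close> of \<open>x s = t\<close>).
\<close>

inductive cml3_eq :: "'g loop_term \<Rightarrow> 'g loop_term \<Rightarrow> bool" where
  refl: "cml3_eq t t"
| sym: "cml3_eq s t \<Longrightarrow> cml3_eq t s"
| trans: "cml3_eq s t \<Longrightarrow> cml3_eq t u \<Longrightarrow> cml3_eq s u"
| cong_Mul: "cml3_eq s s' \<Longrightarrow> cml3_eq t t' \<Longrightarrow> cml3_eq (Mul s t) (Mul s' t')"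
| cong_LDiv: "cml3_eq s s' \<Longrightarrow> cml3_eq t t' \<Longrightarrow> cml3_eq (LDiv s t) (LDiv s' t')"
| cong_RDiv: "cml3_eq s s' \<Longrightarrow> cml3_eq t t' \<Longrightarrow> cml3_eq (RDiv s t) (RDiv s' t')"
| unit_l: "cml3_eq (Mul Unit t) t"
| unit_r: "cml3_eq (Mul t Unit) t"
| Mul_LDiv: "cml3_eq (Mul s (LDiv s t)) t"
| LDiv_Mul: "cml3_eq (LDiv s (Mul s t)) t"
| RDiv_Mul: "cml3_eq (Mul (RDiv t s) s) t"
| Mul_RDiv: "cml3_eq (RDiv (Mul t s) s) t"
| comm: "cml3_eq (Mul s t) (Mul t s)"
| moufang: "cml3_eq (Mul (Mul s t) (Mul u s)) (Mul (Mul s (Mul t u)) s)"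
| exp3: "cml3_eq (Mul (Mul t t) t) Unit"

definition terms_over :: "'g set \<Rightarrow> 'g loop_term set" where
  "terms_over S = {t. set_loop_term t \<subseteq> S}"

definition cml3_rel :: "'g set \<Rightarrow> ('g loop_term \<times> 'g loop_term) set" where
  "cml3_rel S = {(s, t). s \<in> terms_over S \<and> t \<in> terms_over S \<and> cml3_eq s t}"

definition free_CML3 :: "'g set \<Rightarrow> 'g loop_term set monoid" where
  "free_CML3 S =
     \<lparr>carrier = terms_over S // cml3_rel S,
      mult = (\<lambda>A B. \<Union>s\<in>A. \<Union>t\<in>B. cml3_rel S `` {Mul s t}),
      one = cml3_rel S `` {Unit}\<rparr>"

definition free_gen :: "'g set \<Rightarrow> 'g \<Rightarrow> 'g loop_term set" where
  "free_gen S g = cml3_rel S `` {Gen g}"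

definition free_loop :: "nat \<Rightarrow> nat loop_term set monoid" where
  "free_loop n = free_CML3 {..<n}"


subsection \<open>The construction is the free loop\<close>

lemma terms_over_simps [simp]:
  "Gen g \<in> terms_over S \<longleftrightarrow> g \<in> S"
  "Unit \<in> terms_over S"
  "Mul s t \<in> terms_over S \<longleftrightarrow> s \<in> terms_over S \<and> t \<in> terms_over S"
  "LDiv s t \<in> terms_over S \<longleftrightarrow> s \<in> terms_over S \<and> t \<in> terms_over S"
  "RDiv s t \<in> terms_over S \<longleftrightarrow> s \<in> terms_over S \<and> t \<in> terms_over S"
  by (auto simp: terms_over_def)

lemma equiv_cml3_rel: "equiv (terms_over S) (cml3_rel S)"
  by (rule equivI)
    (auto simp: refl_on_def sym_def trans_def cml3_rel_def intro: cml3_eq.intros)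

lemma free_class_eq:
  assumes "s \<in> terms_over S" "t \<in> terms_over S"
  shows "cml3_rel S `` {s} = cml3_rel S `` {t} \<longleftrightarrow> cml3_eq s t"
  using eq_equiv_class_iff[OF equiv_cml3_rel assms] assms by (auto simp: cml3_rel_def)

lemma free_mult:
  assumes "s \<in> terms_over S" "t \<in> terms_over S"
  shows "cml3_rel S `` {s} \<otimes>\<^bsub>free_CML3 S\<^esub> cml3_rel S `` {t} = cml3_rel S `` {Mul s t}"
proof -
  have "congruent2 (cml3_rel S) (cml3_rel S) (\<lambda>s t. cml3_rel S `` {Mul s t})"
    by (rule congruent2I')
      (auto simp: cml3_rel_def intro: cml3_eq.intros, (meson cml3_eq.intros)+)
  then show ?thesis
    unfolding free_CML3_def
    by (simp add: UN_equiv_class2[OF equiv_cml3_rel equiv_cml3_rel _ assms])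
qed

lemma free_one: "\<one>\<^bsub>free_CML3 S\<^esub> = cml3_rel S `` {Unit}"
  by (simp add: free_CML3_def)

lemma free_carrier: "carrier (free_CML3 S) = (\<lambda>t. cml3_rel S `` {t}) ` terms_over S"
  by (auto simp: free_CML3_def quotient_def)

lemma LDiv_unique: "cml3_eq (Mul s x) t \<Longrightarrow> cml3_eq x (LDiv s t)"
  by (meson cml3_eq.intros)

lemma RDiv_unique: "cml3_eq (Mul x s) t \<Longrightarrow> cml3_eq x (RDiv t s)"
  by (meson cml3_eq.intros)

theorem free_CML3_is_CML3: "comm_moufang_loop_exp3 (free_CML3 S)"
proof unfold_locales
  let ?F = "free_CML3 S"
  fix a b assume "a \<in> carrier ?F" "b \<in> carrier ?F"
  then obtain s t where st: "s \<in> terms_over S" "t \<in> terms_over S"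
      "a = cml3_rel S `` {s}" "b = cml3_rel S `` {t}"
    by (auto simp: free_carrier)
  show "\<exists>!x. x \<in> carrier ?F \<and> a \<otimes>\<^bsub>?F\<^esub> x = b"
  proof (rule ex1I[of _ "cml3_rel S `` {LDiv s t}"])
    show "cml3_rel S `` {LDiv s t} \<in> carrier ?F \<and> a \<otimes>\<^bsub>?F\<^esub> cml3_rel S `` {LDiv s t} = b"
      using st by (simp add: free_carrier free_mult free_class_eq cml3_eq.Mul_LDiv)
  next
    fix x assume x: "x \<in> carrier ?F \<and> a \<otimes>\<^bsub>?F\<^esub> x = b"
    then obtain u where u: "u \<in> terms_over S" "x = cml3_rel S `` {u}"
      by (auto simp: free_carrier)
    with x st have "cml3_rel S `` {u} = cml3_rel S `` {LDiv s t}"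
      by (simp add: free_mult free_class_eq LDiv_unique)
    with u show "x = cml3_rel S `` {LDiv s t}" by simp
  qed
  show "\<exists>!x. x \<in> carrier ?F \<and> x \<otimes>\<^bsub>?F\<^esub> a = b"
  proof (rule ex1I[of _ "cml3_rel S `` {RDiv t s}"])
    show "cml3_rel S `` {RDiv t s} \<in> carrier ?F \<and> cml3_rel S `` {RDiv t s} \<otimes>\<^bsub>?F\<^esub> a = b"
      using st by (simp add: free_carrier free_mult free_class_eq cml3_eq.RDiv_Mul)
  next
    fix x assume x: "x \<in> carrier ?F \<and> x \<otimes>\<^bsub>?F\<^esub> a = b"
    then obtain u where u: "u \<in> terms_over S" "x = cml3_rel S `` {u}"
      by (auto simp: free_carrier)
    with x st have "cml3_rel S `` {u} = cml3_rel S `` {RDiv t s}"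
      by (simp add: free_mult free_class_eq RDiv_unique)
    with u show "x = cml3_rel S `` {RDiv t s}" by simp
  qed
next
  let ?F = "free_CML3 S"
  fix x assume "x \<in> carrier ?F"
  then obtain t where t: "t \<in> terms_over S" "x = cml3_rel S `` {t}"
    by (auto simp: free_carrier)
  have "cml3_eq (Mul (Mul (Mul Unit t) t) t) Unit"
    by (meson cml3_eq.intros)
  with t show "x [^]\<^bsub>?F\<^esub> (3::nat) = \<one>\<^bsub>?F\<^esub>"
    by (simp add: nat_pow_def numeral_3_eq_3 free_one free_mult free_class_eq)
qed ((auto simp: free_carrier free_one free_mult)[2],
    (clarsimp simp: free_carrier free_one free_mult free_class_eq,
      rule cml3_eq.unit_l cml3_eq.unit_r cml3_eq.comm cml3_eq.moufang)+)

primrec term_value :: "('a, 'b) monoid_scheme \<Rightarrow> ('g \<Rightarrow> 'a) \<Rightarrow> 'g loop_term \<Rightarrow> 'a" where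
  "term_value M f (Gen g) = f g"
| "term_value M f Unit = \<one>\<^bsub>M\<^esub>"
| "term_value M f (Mul s t) = term_value M f s \<otimes>\<^bsub>M\<^esub> term_value M f t"
| "term_value M f (LDiv s t) =
     (THE x. x \<in> carrier M \<and> term_value M f s \<otimes>\<^bsub>M\<^esub> x = term_value M f t)"
| "term_value M f (RDiv t s) =
     (THE x. x \<in> carrier M \<and> x \<otimes>\<^bsub>M\<^esub> term_value M f s = term_value M f t)"

lemma (in loop) term_value_closed:
  assumes "\<And>g. f g \<in> carrier L"
  shows "term_value L f t \<in> carrier L"
proof (induction t)
  case (LDiv s t)
  then show ?case using theI'[OF l_solve] by auto
next
  case (RDiv s t)
  then show ?case using theI'[OF r_solve] by auto
qed (use assms in auto)

lemma (in comm_moufang_loop_exp3) term_value_sound: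
  assumes "cml3_eq s t" and f: "\<And>g. f g \<in> carrier L"
  shows "term_value L f s = term_value L f t"
proof -
  have closed: "term_value L f u \<in> carrier L" for u
    by (rule term_value_closed) (rule f)
  note moufang_law = moufang and exp3_law = exp3
  show ?thesis
    using assms(1)
  proof induction
    case (Mul_LDiv s t)
    show ?case
      using theI'[OF l_solve[OF closed[of s] closed[of t]]] by simp
  next
    case (RDiv_Mul t s)
    show ?case
      using theI'[OF r_solve[OF closed[of s] closed[of t]]] by simp
  next
    case (LDiv_Mul s t)
    show ?case using closed
      by (auto intro!: the1_equality l_solve)
  next
    case (Mul_RDiv t s)
    show ?case using closed
      by (auto intro!: the1_equality r_solve)
  next
    case (comm s t)
    show ?case using closed by (simp add: m_comm)
  next
    case (moufang s t u)
    show ?case using closed by (simp add: moufang_law)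
  next
    case (exp3 t)
    show ?case using exp3_law[of "term_value L f t"] closed[of t]
      by (simp add: nat_pow_def numeral_3_eq_3)
  qed (use closed in auto)
qed

text \<open>
  The universal property.  The type of \<open>M\<close> is arbitrary, and loop homomorphisms are the same as
  magma homomorphisms.
\<close>

theorem free_CML3_universal:
  assumes M: "comm_moufang_loop_exp3 M" and f: "\<And>g. g \<in> S \<Longrightarrow> f g \<in> carrier M"
  shows "\<exists>h \<in> hom (free_CML3 S) M. \<forall>g\<in>S. h (free_gen S g) = f g"
proof -
  interpret M: comm_moufang_loop_exp3 M by fact
  define f' where "f' g = (if g \<in> S then f g else \<one>\<^bsub>M\<^esub>)" for g
  define v where "v = term_value M f'"
  have f': "f' g \<in> carrier M" for g using f by (auto simp: f'_def)
  define h where "h A = v (SOME t. t \<in> A)" for A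
  have h: "h (cml3_rel S `` {t}) = v t" if "t \<in> terms_over S" for t
  proof -
    have "t \<in> cml3_rel S `` {t}"
      using that by (auto simp: cml3_rel_def intro: cml3_eq.refl)
    then have "(SOME s. s \<in> cml3_rel S `` {t}) \<in> cml3_rel S `` {t}" by (rule someI)
    then have "cml3_eq t (SOME s. s \<in> cml3_rel S `` {t})"
      unfolding cml3_rel_def by blast
    then show ?thesis unfolding h_def v_def by (metis M.term_value_sound f')
  qed
  have "h \<in> hom (free_CML3 S) M"
    by (auto simp: hom_def free_carrier free_mult h)
      (auto simp: v_def intro: M.term_value_closed f')
  moreover have "\<forall>g\<in>S. h (free_gen S g) = f g"
    by (simp add: free_gen_def h) (simp add: v_def f'_def)
  ultimately show ?thesis by blast
qed

theorem free_CML3_generated: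
  assumes H: "subloop H (free_CML3 S)" and gens: "\<And>g. g \<in> S \<Longrightarrow> free_gen S g \<in> H"
  shows "H = carrier (free_CML3 S)"
proof -
  let ?F = "free_CML3 S"
  interpret F: comm_moufang_loop_exp3 ?F by (rule free_CML3_is_CML3)
  interpret H: loop "?F\<lparr>carrier := H\<rparr>" using H by (simp add: subloop_def)
  have sub: "H \<subseteq> carrier ?F" using H by (simp add: subloop_def)
  have "cml3_rel S `` {t} \<in> H" if "t \<in> terms_over S" for t
    using that
  proof (induction t)
    case (Gen g)
    then show ?case using gens by (simp add: free_gen_def)
  next
    case Unit
    then show ?case using H.one_closed by (simp add: free_one)
  next
    case (Mul s t)
    then show ?case using H.m_closed[of "cml3_rel S `` {s}" "cml3_rel S `` {t}"]
      by (simp add: free_mult)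
  next
    case (LDiv s t)
    then obtain x where x: "x \<in> H" "cml3_rel S `` {s} \<otimes>\<^bsub>?F\<^esub> x = cml3_rel S `` {t}"
      using H.l_solve[of "cml3_rel S `` {s}" "cml3_rel S `` {t}"] by auto
    then obtain u where u: "u \<in> terms_over S" "x = cml3_rel S `` {u}"
      using sub by (auto simp: free_carrier)
    with x LDiv show ?case by (metis LDiv_unique free_class_eq free_mult terms_over_simps(3,4))
  next
    case (RDiv t s)
    then obtain x where x: "x \<in> H" "x \<otimes>\<^bsub>?F\<^esub> cml3_rel S `` {s} = cml3_rel S `` {t}"
      using H.r_solve[of "cml3_rel S `` {s}" "cml3_rel S `` {t}"] by auto
    then obtain u where u: "u \<in> terms_over S" "x = cml3_rel S `` {u}"
      using sub by (auto simp: free_carrier)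
    with x RDiv show ?case by (metis RDiv_unique free_class_eq free_mult terms_over_simps(3,5))
  qed
  with sub show ?thesis by (auto simp: free_carrier)
qed

end

theory Submission
  imports Defs "HOL-Library.Product_Plus" "HOL-Library.Numeral_Type"
begin

text \<open>
  The generators of a free loop can be sent to arbitrary elements of a commutative Moufang loop
  of exponent 3, so it suffices to find one such loop and seven elements of it at which the
  iterated associator is not \<open>1\<close>. The loop comes from a commutative alternative algebra in
  characteristic 3.

  Let \<open>R\<close> be an associative supercommutative ring of characteristic 3 with an even derivation
  \<open>D\<close>. Pairs \<open>(f, g)\<close> of an even element \<open>f\<close> and an odd element \<open>g\<close> form an algebra under
  \<open>(f, g) \<bullet> (f', g') = (f f' + g (D g') + g' (D g), f g' + f' g)\<close>; when \<open>R\<close> is a Grassmann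
  algebra over a commutative ring with derivation, this is the Grassmann envelope of a
  superalgebra of vector type. Its associator is
  \<open>- (D f1 g2 g3 + D f2 g3 g1 + D f3 g1 g2, D (g1 g2 g3))\<close> (lemma \<open>vassoc\<close>). It is alternating,
  and it is a derivation in each argument (lemma \<open>inner_der_vmul\<close>). These two facts give the
  Moufang identity and the law \<open>x (x (x y)) = (x x x) y\<close>, so that the elements of cube \<open>1\<close> form
  a commutative Moufang loop of exponent 3 (theorem \<open>vloop\<close>). An associator in this loop is \<open>1\<close>
  plus the associator in the algebra times the inverse of \<open>x (y z)\<close>.

  The associator formula shows how an argument can occur three times. Take \<open>a = (u, r)\<close> with
  \<open>D u \<noteq> 0\<close>. The first occurrence of \<open>a\<close>, together with the odd parts of \<open>x\<close> and \<open>y\<close>, can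
  contribute \<open>D u\<close>; the two other occurrences can contribute their odd part \<open>r\<close>, and a
  derivative taken in between turns one factor \<open>r\<close> into \<open>D r\<close>, so that besides \<open>r r = 0\<close> a
  multiple of \<open>(D r) r\<close> appears, which need not vanish.

  Concretely, \<open>R\<close> is the exterior algebra on eight generators \<open>\<xi>1, \<dots>, \<xi>8\<close> with \<open>D \<xi>i = 0\<close> over
  the group algebra of the group \<open>{1, u, u\<^sup>2}\<close> with \<open>D u = u\<close>. The elements \<open>x, y, z, t, v, w\<close>
  are sent to \<open>(1, \<xi>i)\<close> for \<open>i = 1, \<dots>, 6\<close> and \<open>a\<close> to \<open>(u, \<xi>7 + u\<^sup>2 \<xi>8)\<close>. The iterated associator
  then has the value \<open>(1 + \<xi>1 \<xi>2 \<xi>3 \<xi>4 \<xi>5 \<xi>6 \<xi>7 \<xi>8, 0)\<close> (lemma \<open>word_value\<close>).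

  The same argument applies to any seven distinct generators of a larger free loop, the
  remaining ones being sent to \<open>1\<close>, and the iterated associator belongs to \<open>TAH\<close>; hence the
  statement for all \<open>n \<ge> 7\<close>.
\<close>

section \<open>Supercommutative differential rings of characteristic 3\<close>

text \<open>
  The grading is recorded by its involution \<open>grade\<close>, which is \<open>1\<close> on the even and \<open>-1\<close> on the
  odd part. The last two axioms are supercommutativity. In \<open>odd_commute\<close> the second factor is
  arbitrary: both parities are covered by one equation, and this form passes directly to the
  exterior extension constructed later.
\<close>
class diff_superring3 = ring_1 +
  fixes grade :: "'a \<Rightarrow> 'a" and der :: "'a \<Rightarrow> 'a"
  assumes grade_add: "grade (x + y) = grade x + grade y"
    and grade_mult: "grade (x * y) = grade x * grade y"
    and grade_grade: "grade (grade x) = x"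
    and der_add: "der (x + y) = der x + der y"
    and der_mult: "der (x * y) = der x * y + x * der y"
    and grade_der: "grade (der x) = der (grade x)"
    and char3: "x + (x + x) = 0"
    and even_commute: "grade x = x \<Longrightarrow> x * y = y * x"
    and odd_commute: "grade x = - x \<Longrightarrow> x * grade y = y * x"
begin

lemma grade_0 [simp]: "grade 0 = 0"
  using grade_add[of 0 0] by simp

lemma grade_minus [simp]: "grade (- x) = - grade x"
  using grade_add[of x "- x"] by (simp add: eq_neg_iff_add_eq_0 add.commute)

lemma grade_diff: "grade (x - y) = grade x - grade y"
  using grade_add[of x "- y"] by simp

lemma grade_1 [simp]: "grade 1 = 1"
  using grade_mult[of 1 "grade 1"] by (simp add: grade_grade)

lemma der_0 [simp]: "der 0 = 0"
  using der_add[of 0 0] by simp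

lemma der_minus [simp]: "der (- x) = - der x"
  using der_add[of x "- x"] by (simp add: eq_neg_iff_add_eq_0 add.commute)

lemma der_1 [simp]: "der 1 = 0"
  using der_mult[of 1 1] by simp

lemma odd_anticommute: "grade x = - x \<Longrightarrow> grade y = - y \<Longrightarrow> y * x = - (x * y)"
  using odd_commute[of x y] by simp

lemma double_eq_minus: "x + x = - x"
  using char3[of x] by (simp add: eq_neg_iff_add_eq_0 add.assoc)

lemma eq_minus_self: "x = - x \<Longrightarrow> x = 0"
  using char3[of x] by (metis double_eq_minus add_cancel_left_right)

lemma odd_square: "grade x = - x \<Longrightarrow> x * x = 0"
  by (rule eq_minus_self) (rule odd_anticommute)

lemma odd_square_left: "grade x = - x \<Longrightarrow> x * (x * y) = 0"
  by (metis odd_square mult_zero_left mult_assoc)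

end

text \<open>
  Rewrite rules that bring monomials into a fixed order of their factors. For termination they
  have to be instantiated with specific pairs of factors.
\<close>
lemma odd_sort:
  assumes "grade g = - g" "grade h = - (h::'a::diff_superring3)"
  shows "h * g = - (g * h)" "h * (g * x) = - (g * (h * x))"
proof -
  show *: "h * g = - (g * h)" using odd_anticommute assms by blast
  show "h * (g * x) = - (g * (h * x))" using arg_cong[OF *, of "\<lambda>z. z * x"] by (simp add: mult.assoc)
qed

lemma even_sort:
  assumes "grade f = (f::'a::diff_superring3)"
  shows "x * f = f * x" "x * (f * y) = f * (x * y)"
  using even_commute[OF assms, of x] by (simp_all flip: mult.assoc)

section \<open>The commutative alternative algebra of vector type\<close>

text \<open>
  On odd elements this is the bracket \<open>g (D h) - (D g) h\<close>, written so that its symmetry is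
  visible.
\<close>
definition pairing :: "'a \<Rightarrow> 'a \<Rightarrow> 'a::diff_superring3" where
  "pairing g h = g * der h + h * der g"

definition vmul :: "'a \<times> 'a \<Rightarrow> 'a \<times> 'a \<Rightarrow> 'a \<times> 'a::diff_superring3" (infixl \<open>\<bullet>\<close> 70) where
  "x \<bullet> y = (fst x * fst y + pairing (snd x) (snd y), fst x * snd y + fst y * snd x)"

definition even_odd :: "('a::diff_superring3 \<times> 'a) set" where
  "even_odd = {(f, g). grade f = f \<and> grade g = - g}"

lemma pairing_commute: "pairing g h = pairing h g"
  by (simp add: pairing_def add.commute)

lemma pairing_0 [simp]: "pairing 0 g = 0" "pairing g 0 = 0"
  by (simp_all add: pairing_def)

lemma pairing_add:
  "pairing (g + g') h = pairing g h + pairing g' h" "pairing h (g + g') = pairing h g + pairing h g'"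
  by (simp_all add: pairing_def der_add algebra_simps)

lemma pairing_even: "grade g = - g \<Longrightarrow> grade h = - h \<Longrightarrow> grade (pairing g h) = pairing g h"
  by (simp add: pairing_def grade_add grade_mult grade_der)

text \<open>
  The pairing is not bilinear over the even part. The defect \<open>der f * (h * g)\<close> is where the
  derivatives of the even parts enter the associator.
\<close>
lemma pairing_scale:
  assumes "grade f = f" "grade g = - g" "grade h = - h"
  shows "pairing (f * g) h = f * pairing g h + der f * (h * g)"
proof -
  have "h * f = f * h" "h * der f = der f * h"
    using even_commute[of f h] even_commute[of "der f" h] assms by (simp_all add: grade_der)
  then show ?thesis
    by (simp add: pairing_def der_mult distrib_left add.assoc) (simp flip: mult.assoc)
qed

text \<open>
  The three terms with a derivative of an even part come from \<open>pairing_scale\<close>. The one with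
  \<open>der f2\<close> arises twice with the same sign, and \<open>2 = -1\<close> makes the formula cyclically symmetric;
  the same happens to the term with \<open>der g2\<close> in the odd part.
\<close>
lemma vassoc:
  assumes "(f1, g1) \<in> even_odd" "(f2, g2) \<in> even_odd" "(f3, g3) \<in> even_odd"
  shows "(f1, g1) \<bullet> (f2, g2) \<bullet> (f3, g3) - (f1, g1) \<bullet> ((f2, g2) \<bullet> (f3, g3)) =
    - (der f1 * (g2 * g3) + der f2 * (g3 * g1) + der f3 * (g1 * g2), der (g1 * (g2 * g3)))"
proof -
  have even: "grade f1 = f1" "grade f2 = f2" "grade f3 = f3"
    and odd: "grade g1 = - g1" "grade g2 = - g2" "grade g3 = - g3"
    using assms by (simp_all add: even_odd_def)
  have dodd: "grade (der g1) = - der g1" "grade (der g2) = - der g2" "grade (der g3) = - der g3"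
    using odd by (simp_all add: grade_der)
  have "f3 * (f1 * z) = f1 * (f3 * z)" "f3 * (f2 * z) = f2 * (f3 * z)"
      "f3 * f1 = f1 * f3" "f3 * f2 = f2 * f3" "pairing g1 g2 * f3 = f3 * pairing g1 g2" for z
    by (rule even_sort[OF even(1)] even_sort[OF even(2)] even_sort[OF even(3)])+
  moreover have "pairing (f1 * g2 + f2 * g1) g3 - pairing g1 (f2 * g3 + f3 * g2) =
     f1 * pairing g2 g3 - f3 * pairing g1 g2 - (der f1 * (g2 * g3) + der f2 * (g3 * g1) + der f3 * (g1 * g2))"
    using odd_sort(1)[OF odd(2,3)] odd_sort(1)[OF odd(1,3)] char3[of "der f2 * (g1 * g3)"]
    by (simp add: pairing_add pairing_commute[of g1 "f2 * g3"] pairing_commute[of g1 "f3 * g2"]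
        pairing_scale even odd pairing_commute[of g1 g3] pairing_commute[of g2 g1] algebra_simps)
  moreover have "pairing g1 g2 * g3 - pairing g2 g3 * g1 = - der (g1 * (g2 * g3))"
    using char3[of "g1 * (der g2 * g3)"]
    by (simp add: pairing_def der_mult algebra_simps
      odd_sort[OF odd(1) odd(2)] odd_sort[OF odd(1) odd(3)] odd_sort[OF odd(2) odd(3)]
      odd_sort[OF odd(1) dodd(2)] odd_sort[OF odd(1) dodd(3)] odd_sort[OF odd(2) dodd(3)]
      odd_sort[OF dodd(1) odd(2)] odd_sort[OF dodd(1) odd(3)] odd_sort[OF dodd(2) odd(3)])
  ultimately show ?thesis
    by (simp add: vmul_def algebra_simps)
qed

lemma vmul_commute:
  assumes "x \<in> even_odd" "y \<in> even_odd"
  shows "x \<bullet> y = y \<bullet> x"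
  using assms even_commute[of "fst x" "fst y"]
  by (auto simp: vmul_def even_odd_def pairing_commute add.commute)

lemma vmul_add: "(x + x') \<bullet> y = x \<bullet> y + x' \<bullet> y" "y \<bullet> (x + x') = y \<bullet> x + y \<bullet> x'"
  by (simp_all add: vmul_def pairing_add algebra_simps)

lemma even_odd_closed [simp]:
  "x \<in> even_odd \<Longrightarrow> y \<in> even_odd \<Longrightarrow> x \<bullet> y \<in> even_odd"
  "(1, 0) \<in> even_odd"
  by (auto simp: even_odd_def vmul_def pairing_even grade_mult grade_add grade_diff)

text \<open>
  By \<open>vassoc\<close> the associator is, as a function of its first argument, of this shape: \<open>w\<close> is the
  product of the odd parts of the other two arguments, and \<open>t\<close> collects the derivatives of their
  even parts.
\<close>
definition inner_der :: "'a \<Rightarrow> 'a \<Rightarrow> 'a \<times> 'a \<Rightarrow> 'a \<times> 'a::diff_superring3" where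
  "inner_der w t x = (w * der (fst x) + t * snd x, der (w * snd x))"

text \<open>
  For arbitrary even \<open>w\<close> and odd \<open>t\<close> this is a derivation of the algebra. Expanding the pairings
  of \<open>der (w * g)\<close> and \<open>der (w * g')\<close> leaves three equal terms \<open>der w * pairing g g'\<close>, which
  cancel in characteristic 3, and a multiple of \<open>g * g' + g' * g = 0\<close>.
\<close>
lemma inner_der_vmul:
  assumes w: "grade w = w" and t: "grade t = - t" and "x \<in> even_odd" "y \<in> even_odd"
  shows "inner_der w t (x \<bullet> y) = inner_der w t x \<bullet> y + x \<bullet> inner_der w t y"
proof -
  obtain f g f' g' where xy: "x = (f, g)" "y = (f', g')" by (cases x; cases y)
  have f: "grade f = f" "grade f' = f'" "grade (der f) = der f" "grade (der f') = der f'"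
    and g: "grade g = - g" "grade g' = - g'" "grade (der g) = - der g" "grade (der g') = - der g'"
    using assms xy by (simp_all add: even_odd_def grade_der)
  have dw: "grade (der w) = der w" using w by (simp add: grade_der)
  note sort = even_sort[OF f(1), of f'] even_sort[OF f(1), of w] even_sort[OF f(1), of t]
    even_sort[OF f(2), of w] even_sort[OF f(2), of t] even_sort[OF f(2), of g]
    even_sort[OF f(2), of "der f"]
    even_sort[OF f(1), of "der w"] even_sort[OF f(2), of "der w"]
    even_sort[OF f(3), of w] even_sort[OF f(4), of w]
  have pair: "w * der (pairing g g') = pairing (der (w * g)) g' + pairing g (der (w * g'))"
  proof -
    have 1: "pairing (der (w * g)) g' =
      w * pairing (der g) g' + der w * (g' * der g) + der w * pairing g g' + der (der w) * (g' * g)"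
      using w dw g by (simp add: der_mult pairing_add pairing_scale grade_der)
    have 2: "pairing g (der (w * g')) =
      w * pairing g (der g') + der w * (g * der g') + der w * pairing g g' + der (der w) * (g * g')"
      using w dw g
      by (subst (1 2 3) pairing_commute) (simp add: der_mult pairing_add pairing_scale grade_der)
    have "pairing (der (w * g)) g' + pairing g (der (w * g')) =
      w * (pairing (der g) g' + pairing g (der g'))
      + (der w * pairing g g' + (der w * pairing g g' + der w * (g * der g' + g' * der g)))
      + der (der w) * (g * g' + g' * g)"
      unfolding 1 2 by (simp add: distrib_left ac_simps)
    also have "\<dots> = w * (pairing (der g) g' + pairing g (der g'))"
      using odd_sort(1)[OF g(1,2)] char3[of "der w * pairing g g'"] by (simp flip: pairing_def)
    also have "\<dots> = w * der (pairing g g')"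
      by (simp add: pairing_def der_add der_mult distrib_left ac_simps)
    finally show ?thesis ..
  qed
  show ?thesis
    by (simp add: xy vmul_def inner_der_def pair der_add distrib_left distrib_right
       mult.assoc der_mult sort odd_sort(1)[OF g(1,2)] odd_sort[OF t g(1)] odd_sort[OF t g(2)] ac_simps)
qed

lemma vmul_diff: "(x - x') \<bullet> y = x \<bullet> y - x' \<bullet> y" "y \<bullet> (x - x') = y \<bullet> x - y \<bullet> x'"
  using vmul_add[of "x - x'" x' y] vmul_add(2)[of y "x - x'" x'] by simp_all

lemma vmul_0 [simp]: "0 \<bullet> x = 0" "x \<bullet> 0 = 0"
  by (simp_all add: vmul_def zero_prod_def)

lemma vmul_one [simp]: "(1, 0) \<bullet> x = x" "x \<bullet> (1, 0) = x"
  by (simp_all add: vmul_def)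

lemma vassoc_inner_der:
  assumes "x \<in> even_odd" "y \<in> even_odd" "z \<in> even_odd"
  shows "x \<bullet> y \<bullet> z - x \<bullet> (y \<bullet> z) =
    - inner_der (snd y * snd z) (der (fst y) * snd z - der (fst z) * snd y) x"
proof -
  obtain f1 g1 f2 g2 f3 g3 where xyz: "x = (f1, g1)" "y = (f2, g2)" "z = (f3, g3)"
    by (cases x; cases y; cases z)
  have g: "grade g1 = - g1" "grade g2 = - g2" "grade g3 = - g3"
    and f: "grade (der f1) = der f1"
    using assms by (simp_all add: xyz even_odd_def grade_der)
  show ?thesis
    using vassoc[of f1 g1 f2 g2 f3 g3] assms
    by (simp add: xyz inner_der_def algebra_simps even_sort[OF f, of g2] even_sort[OF f, of g3]
      odd_sort[OF g(1,2)] odd_sort[OF g(1,3)] odd_sort[OF g(2,3)])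
qed

lemma vassoc_cyclic:
  assumes "x \<in> even_odd" "y \<in> even_odd" "z \<in> even_odd"
  shows "y \<bullet> z \<bullet> x - y \<bullet> (z \<bullet> x) = x \<bullet> y \<bullet> z - x \<bullet> (y \<bullet> z)"
proof -
  obtain f1 g1 f2 g2 f3 g3 where xyz: "x = (f1, g1)" "y = (f2, g2)" "z = (f3, g3)"
    by (cases x; cases y; cases z)
  have g: "grade g1 = - g1" "grade g2 = - g2" "grade g3 = - g3"
    using assms by (simp_all add: xyz even_odd_def)
  have "g2 * (g3 * g1) = g1 * (g2 * g3)"
    by (simp add: odd_sort[OF g(1,2)] odd_sort[OF g(1,3)])
  then show ?thesis
    using assms vassoc[of f1 g1 f2 g2 f3 g3] vassoc[of f2 g2 f3 g3 f1 g1]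
    by (simp add: xyz add_ac)
qed

lemma vassoc_flexible:
  assumes "x \<in> even_odd" "z \<in> even_odd"
  shows "x \<bullet> z \<bullet> x - x \<bullet> (z \<bullet> x) = 0"
  using assms by (simp add: vmul_commute[of "x \<bullet> z" x] vmul_commute[of z x])

text \<open>
  The derivation given by the associator with \<open>z\<close> and \<open>x\<close> kills \<open>x\<close> by flexibility, so applying
  it to \<open>x \<bullet> y\<close> just multiplies its value at \<open>y\<close> by \<open>x\<close>. This is the Moufang identity in
  disguise.
\<close>
lemma vassoc_mult_same:
  assumes x: "x \<in> even_odd" and y: "y \<in> even_odd" and z: "z \<in> even_odd"
  shows "x \<bullet> y \<bullet> z \<bullet> x - x \<bullet> y \<bullet> (z \<bullet> x) = x \<bullet> (x \<bullet> y \<bullet> z - x \<bullet> (y \<bullet> z))"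
proof -
  let ?d = "inner_der (snd z * snd x) (der (fst z) * snd x - der (fst x) * snd z)"
  have d: "u \<bullet> z \<bullet> x - u \<bullet> (z \<bullet> x) = - ?d u" if "u \<in> even_odd" for u
    using vassoc_inner_der[OF that z x] .
  have "?d x = 0"
    using d[OF x] vassoc_flexible[OF x z] by simp
  have "grade (snd z * snd x) = snd z * snd x"
    "grade (der (fst z) * snd x - der (fst x) * snd z) = - (der (fst z) * snd x - der (fst x) * snd z)"
    using x z by (auto simp: even_odd_def grade_mult grade_diff grade_der)
  from inner_der_vmul[OF this x y] have "?d (x \<bullet> y) = x \<bullet> ?d y"
    by (simp add: \<open>?d x = 0\<close>)
  with d[of "x \<bullet> y"] d[OF y] x y
  have "x \<bullet> y \<bullet> z \<bullet> x - x \<bullet> y \<bullet> (z \<bullet> x) = x \<bullet> (y \<bullet> z \<bullet> x - y \<bullet> (z \<bullet> x))"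
    using vmul_diff(2)[of x 0 "?d y"] by simp
  with vassoc_cyclic[OF x y z] show ?thesis by simp
qed

lemma vmul_moufang:
  assumes "x \<in> even_odd" "y \<in> even_odd" "z \<in> even_odd"
  shows "x \<bullet> y \<bullet> (z \<bullet> x) = x \<bullet> (y \<bullet> z) \<bullet> x"
  using vassoc_mult_same[OF assms] assms
  by (simp add: vmul_diff vmul_commute[of _ x] del: diff_eq_diff_eq)

lemma vmul_left_alternative:
  assumes "x \<in> even_odd" "y \<in> even_odd"
  shows "x \<bullet> x \<bullet> y = x \<bullet> (x \<bullet> y)"
  using vassoc_cyclic[OF assms(1,1,2)] vassoc_flexible[OF assms] by simp

lemma vmul_cube:
  assumes "x \<in> even_odd" "y \<in> even_odd"
  shows "x \<bullet> x \<bullet> x \<bullet> y = x \<bullet> (x \<bullet> (x \<bullet> y))"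
proof -
  have "x \<bullet> (x \<bullet> x) \<bullet> y - x \<bullet> (x \<bullet> x \<bullet> y) = x \<bullet> x \<bullet> y \<bullet> x - x \<bullet> x \<bullet> (y \<bullet> x)"
    using vassoc_cyclic[of x "x \<bullet> x" y] assms by simp
  also have "\<dots> = 0"
    using vassoc_mult_same[OF assms(1,1,2)] vmul_left_alternative[OF assms] by simp
  finally show ?thesis
    using vmul_left_alternative[OF assms] assms by (simp add: vmul_commute[of "x \<bullet> x" x])
qed

section \<open>The loop of elements of cube 1\<close>

lemma vmul_cube_eq:
  assumes "(f, g) \<in> even_odd"
  shows "(f, g) \<bullet> (f, g) \<bullet> (f, g) = (f * f * f, 0)"
proof -
  have f: "grade f = f" and g: "grade g = - g" "grade (der g) = - der g"
    using assms by (simp_all add: even_odd_def grade_der)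
  let ?P = "pairing g g"
  have "?P * f = f * ?P"
    by (rule even_sort(1)[OF f])
  then have "(f * f + ?P) * f + pairing (f * g + f * g) g = f * f * f + (f * ?P + (f * ?P + f * ?P))"
    by (simp add: pairing_add pairing_scale f g odd_square distrib_right)
  moreover have "?P * g = 0"
    by (simp add: pairing_def distrib_right mult.assoc odd_sort(1)[OF g] odd_square_left[OF g(1)])
  then have "(f * f + ?P) * g + f * (f * g + f * g) = f * f * g + (f * f * g + f * f * g)"
    by (simp add: distrib_left distrib_right mult.assoc)
  ultimately show ?thesis
    by (simp add: vmul_def char3)
qed

lemma cube_add_commuting:
  fixes a b :: "'a::diff_superring3"
  assumes "a * b = b * a"
  shows "(a + b) * (a + b) * (a + b) = a * a * a + b * b * b"
proof -
  have sort: "b * (a * z) = a * (b * z)" for z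
    using assms by (metis mult.assoc)
  show ?thesis
    using char3[of "a * (a * b)"] char3[of "a * (b * b)"]
    by (simp add: algebra_simps sort assms[symmetric])
qed

text \<open>
  Both summands of the pairing have square zero because they contain an odd factor, and they
  commute.
\<close>
lemma pairing_cube:
  assumes "grade g = - g" "grade h = - h"
  shows "pairing g h * pairing g h * pairing g h = 0"
proof -
  have d: "grade (der g) = - der g" "grade (der h) = - der h"
    using assms by (simp_all add: grade_der)
  have "g * der h * (g * der h) = 0" "h * der g * (h * der g) = 0"
    by (simp_all add: mult.assoc odd_sort(2)[OF assms(1) d(2)] odd_sort(2)[OF assms(2) d(1)]
        odd_square_left assms)
  moreover have "g * der h * (h * der g) = h * der g * (g * der h)"
    by (rule even_commute) (simp add: grade_mult assms d)
  ultimately show ?thesis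
    by (simp add: pairing_def cube_add_commuting)
qed

text \<open>
  By \<open>vmul_cube_eq\<close> the condition on the cube only restricts the even part.
\<close>
definition vloop :: "('a::diff_superring3 \<times> 'a) monoid" where
  "vloop = \<lparr>carrier = {x \<in> even_odd. x \<bullet> x \<bullet> x = (1, 0)}, mult = (\<bullet>), one = (1, 0)\<rparr>"

lemma vloop_simps [simp]:
  "x \<in> carrier vloop \<longleftrightarrow> x \<in> even_odd \<and> x \<bullet> x \<bullet> x = (1, 0)"
  "x \<otimes>\<^bsub>vloop\<^esub> y = x \<bullet> y" "\<one>\<^bsub>vloop\<^esub> = (1, 0)"
  by (simp_all add: vloop_def)

lemma vloop_closed:
  assumes "x \<in> carrier vloop" "y \<in> carrier vloop"
  shows "x \<bullet> y \<in> carrier vloop"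
proof -
  obtain f g f' g' where xy: "x = (f, g)" "y = (f', g')" by (cases x; cases y)
  have p: "(f, g) \<in> even_odd" "(f', g') \<in> even_odd" using assms xy by simp_all
  then have f: "grade f = f" "grade f' = f'" and g: "grade g = - g" "grade g' = - g'"
    by (simp_all add: even_odd_def)
  have cube: "f * f * f = 1" "f' * f' * f' = 1"
    using assms p by (simp_all add: xy vmul_cube_eq)
  have "f * f' * (f * f') * (f * f') = f * f * f * (f' * f' * f')"
    by (simp add: mult.assoc even_sort[OF f(1), of f'])
  moreover have "f * f' * pairing g g' = pairing g g' * (f * f')"
    by (rule even_commute) (simp add: f grade_mult)
  ultimately have "(f * f' + pairing g g') * (f * f' + pairing g g') * (f * f' + pairing g g') = 1"
    by (simp add: cube cube_add_commuting pairing_cube[OF g])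
  then show ?thesis
    using vmul_cube_eq[of "f * f' + pairing g g'" "f * g' + f' * g"] even_odd_closed(1)[OF p]
    by (simp add: xy vmul_def)
qed

text \<open>
  By \<open>vmul_cube\<close> the third power of the left multiplication by an element of cube \<open>1\<close> is the
  identity, so \<open>a \<bullet> (a \<bullet> b)\<close> is the solution of \<open>a \<bullet> x = b\<close>.
\<close>
theorem vloop: "comm_moufang_loop_exp3 (vloop :: ('a::diff_superring3 \<times> 'a) monoid)"
proof -
  let ?L = "vloop :: ('a \<times> 'a) monoid"
  have solve: "\<exists>!x. x \<in> carrier ?L \<and> a \<bullet> x = b" if a: "a \<in> carrier ?L" and b: "b \<in> carrier ?L" for a b
  proof (rule ex1I)
    have "a \<bullet> (a \<bullet> (a \<bullet> b)) = b" using vmul_cube[of a b] a b by simp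
    then show "a \<bullet> (a \<bullet> b) \<in> carrier ?L \<and> a \<bullet> (a \<bullet> (a \<bullet> b)) = b"
      using vloop_closed[OF a vloop_closed[OF a b]] by blast
  next
    fix x assume "x \<in> carrier ?L \<and> a \<bullet> x = b"
    then show "x = a \<bullet> (a \<bullet> b)" using vmul_cube[of a x] a by auto
  qed
  have comm: "x \<bullet> y = y \<bullet> x" if "x \<in> carrier ?L" "y \<in> carrier ?L" for x y
    using that vmul_commute[of x y] by simp
  show ?thesis
  proof
    fix x y assume xy: "x \<in> carrier ?L" "y \<in> carrier ?L"
    show "x \<otimes>\<^bsub>?L\<^esub> y \<in> carrier ?L" "x \<otimes>\<^bsub>?L\<^esub> y = y \<otimes>\<^bsub>?L\<^esub> x"
      unfolding vloop_simps(2) by (fact vloop_closed[OF xy] comm[OF xy])+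
    show "\<exists>!z. z \<in> carrier ?L \<and> x \<otimes>\<^bsub>?L\<^esub> z = y"
      unfolding vloop_simps(2) by (fact solve[OF xy])
    moreover have "z \<in> carrier ?L \<and> x \<otimes>\<^bsub>?L\<^esub> z = y \<longleftrightarrow> z \<in> carrier ?L \<and> z \<otimes>\<^bsub>?L\<^esub> x = y" for z
      unfolding vloop_simps(2) using comm[OF xy(1)] by metis
    ultimately show "\<exists>!z. z \<in> carrier ?L \<and> z \<otimes>\<^bsub>?L\<^esub> x = y" by simp
  next
    fix x y z assume "x \<in> carrier ?L" "y \<in> carrier ?L" "z \<in> carrier ?L"
    then show "x \<otimes>\<^bsub>?L\<^esub> y \<otimes>\<^bsub>?L\<^esub> (z \<otimes>\<^bsub>?L\<^esub> x) = x \<otimes>\<^bsub>?L\<^esub> (y \<otimes>\<^bsub>?L\<^esub> z) \<otimes>\<^bsub>?L\<^esub> x"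
      using vmul_moufang[of x y z] by simp
  next
    fix x assume "x \<in> carrier ?L"
    then show "x [^]\<^bsub>?L\<^esub> (3::nat) = \<one>\<^bsub>?L\<^esub>"
      by (simp add: nat_pow_def numeral_3_eq_3)
  qed simp_all
qed

section \<open>Associators and homomorphisms\<close>

lemma (in comm_moufang_loop) inv_eqI:
  assumes "x \<in> carrier L" "y \<in> carrier L" "x \<otimes> y = \<one>"
  shows "inv x = y"
  unfolding m_inv_def
proof (rule the_equality)
  show "y \<in> carrier L \<and> x \<otimes> y = \<one> \<and> y \<otimes> x = \<one>" using assms m_comm by auto
  show "z = y" if "z \<in> carrier L \<and> x \<otimes> z = \<one> \<and> z \<otimes> x = \<one>" for z
    using that l_solve[of x \<one>] assms by auto
qed

lemma (in comm_moufang_loop) inv_closed_eq: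
  assumes "x \<in> carrier L"
  shows "inv x \<in> carrier L" "x \<otimes> inv x = \<one>"
  using l_solve[OF assms one_closed] inv_eqI[OF assms] by auto

lemma (in comm_moufang_loop) associator_closed:
  "x \<in> carrier L \<Longrightarrow> y \<in> carrier L \<Longrightarrow> z \<in> carrier L \<Longrightarrow> associator L x y z \<in> carrier L"
  by (simp add: associator_def inv_closed_eq)

lemma hom_one:
  assumes "comm_moufang_loop L" "comm_moufang_loop M" "h \<in> hom L M"
  shows "h \<one>\<^bsub>L\<^esub> = \<one>\<^bsub>M\<^esub>"
proof -
  interpret L: comm_moufang_loop L by fact
  interpret M: comm_moufang_loop M by fact
  have 1: "h \<one>\<^bsub>L\<^esub> \<in> carrier M" using assms(3) by (simp add: hom_def Pi_iff)
  have "h \<one>\<^bsub>L\<^esub> \<otimes>\<^bsub>M\<^esub> h \<one>\<^bsub>L\<^esub> = h \<one>\<^bsub>L\<^esub>"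
    using hom_mult[OF assms(3) L.one_closed L.one_closed] by simp
  then show ?thesis
    using M.l_solve[OF 1 1] 1 M.r_one[OF 1] by (metis M.one_closed)
qed

lemma hom_associator:
  assumes "comm_moufang_loop L" "comm_moufang_loop M" "h \<in> hom L M"
    and "x \<in> carrier L" "y \<in> carrier L" "z \<in> carrier L"
  shows "h (associator L x y z) = associator M (h x) (h y) (h z)"
proof -
  interpret L: comm_moufang_loop L by fact
  interpret M: comm_moufang_loop M by fact
  have closed: "h u \<in> carrier M" if "u \<in> carrier L" for u
    using assms(3) that by (auto simp: hom_def)
  have "h (inv\<^bsub>L\<^esub> u) = inv\<^bsub>M\<^esub> (h u)" if "u \<in> carrier L" for u
    using that hom_mult[OF assms(3), of u "inv\<^bsub>L\<^esub> u"] hom_one[OF assms(1-3)]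
    by (intro M.inv_eqI[symmetric]) (simp_all add: closed L.inv_closed_eq)
  then show ?thesis
    using assms(4-6) by (simp add: associator_def hom_mult[OF assms(3)] L.inv_closed_eq)
qed

lemma associator_vloop:
  assumes "x \<in> carrier vloop" "y \<in> carrier vloop" "z \<in> carrier vloop"
  shows "associator vloop x y z = x \<bullet> y \<bullet> z \<bullet> (x \<bullet> (y \<bullet> z) \<bullet> (x \<bullet> (y \<bullet> z)))"
proof -
  interpret comm_moufang_loop_exp3 vloop by (rule vloop)
  let ?q = "x \<bullet> (y \<bullet> z)"
  have q: "?q \<in> carrier vloop" "?q \<bullet> ?q \<in> carrier vloop" using assms by (auto intro!: vloop_closed simp del: vloop_simps)
  then have "?q \<bullet> (?q \<bullet> ?q) = (1, 0)" using vmul_commute[of ?q "?q \<bullet> ?q"] by simp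
  with inv_eqI[OF q] show ?thesis by (simp add: associator_def)
qed

section \<open>The group algebra of order 3 and exterior extensions\<close>

text \<open>
  The group algebra over the field with three elements of the cyclic group generated by \<open>u\<close>: the
  entries are the coefficients of \<open>1\<close>, \<open>u\<close> and \<open>u * u\<close>. The derivation multiplies \<open>u ^ i\<close> by
  \<open>i\<close>.
\<close>
datatype grp3 = Grp3 3 3 3

instantiation grp3 :: diff_superring3
begin
definition "0 = Grp3 0 0 0"
definition "1 = Grp3 1 0 0"
fun plus_grp3 where "Grp3 a b c + Grp3 a' b' c' = Grp3 (a + a') (b + b') (c + c')"
fun minus_grp3 where "Grp3 a b c - Grp3 a' b' c' = Grp3 (a - a') (b - b') (c - c')"
fun uminus_grp3 where "- Grp3 a b c = Grp3 (- a) (- b) (- c)"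
fun times_grp3 where "Grp3 a b c * Grp3 a' b' c' =
  Grp3 (a * a' + b * c' + c * b') (a * b' + b * a' + c * c') (a * c' + b * b' + c * a')"
definition "grade (x :: grp3) = x"
fun der_grp3 where "der (Grp3 a b c) = Grp3 0 b (- c)"

lemma numerals_3: "(2 :: 3) = - 1" "(3 :: 3) = 0"
  by simp_all

instance
proof
  fix x y z :: grp3
  show "x + (x + x) = 0"
    by (cases x) (simp add: zero_grp3_def numerals_3)
  show comm: "x * y = y * x" for x y :: grp3
    by (cases x; cases y) (simp add: algebra_simps)
  show "grade x = - x \<Longrightarrow> x * grade y = y * x"
    by (simp add: grade_grp3_def comm)
  show "x * y * z = x * (y * z)"
    by (cases x; cases y; cases z) (simp add: algebra_simps)
  show "(x + y) * z = x * z + y * z" "x * (y + z) = x * y + x * z"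
    by (cases x; cases y; cases z; simp add: algebra_simps)+
  (* needed for u^2 * u^2 = u, where the product rule gives the factor -1 - 1 instead of 1 *)
  have double: "a = b - (c + c) \<longleftrightarrow> a = b + c" for a b c :: 3
  proof -
    have "c + c = - c"
      using numerals_3 by (metis mult_2 mult_minus1)
    then show ?thesis by (simp only: diff_minus_eq_add)
  qed
  show "der (x * y) = der x * y + x * der y"
    by (cases x; cases y) (simp add: algebra_simps double numerals_3)
  show "x + y + z = x + (y + z)"
    by (cases x; cases y; cases z) simp
  show "x + y = y + x" "x - y = x + - y" "der (x + y) = der x + der y"
    by (cases x; cases y; simp)+
  show "0 + x = x" "- x + x = 0" "1 * x = x" "x * 1 = x"
    by (cases x; simp add: zero_grp3_def one_grp3_def)+
qed (simp_all add: zero_grp3_def one_grp3_def grade_grp3_def)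

end

text \<open>
  \<open>Ext a b\<close> stands for \<open>a + b \<xi>\<close> with a new odd generator \<open>\<xi>\<close> of derivative \<open>0\<close> that
  anticommutes with the odd elements; \<open>(a + b \<xi>) (c + d \<xi>) = a c + (a d + b (grade c)) \<xi>\<close> since
  \<open>\<xi> c = (grade c) \<xi>\<close>.
\<close>
datatype 'a ext = Ext 'a 'a

instantiation ext :: (diff_superring3) diff_superring3
begin
definition "0 = Ext 0 0"
definition "1 = Ext 1 0"
fun plus_ext where "Ext a b + Ext c d = Ext (a + c) (b + d)"
fun minus_ext where "Ext a b - Ext c d = Ext (a - c) (b - d)"
fun uminus_ext where "- Ext a b = Ext (- a) (- b)"
fun times_ext where "Ext a b * Ext c d = Ext (a * c) (a * d + b * grade c)"
fun grade_ext where "grade (Ext a b) = Ext (grade a) (- grade b)"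
fun der_ext where "der (Ext a b) = Ext (der a) (der b)"

instance
proof
  fix x y z :: "'a ext"
  show "x + y + z = x + (y + z)" "x * y * z = x * (y * z)"
      "(x + y) * z = x * z + y * z" "x * (y + z) = x * y + x * z"
    by (cases x; cases y; cases z;
        simp add: algebra_simps grade_add grade_mult grade_grade)+
  show "x + y = y + x" "grade (x + y) = grade x + grade y" "grade (x * y) = grade x * grade y"
       "der (x + y) = der x + der y" "der (x * y) = der x * y + x * der y" "x - y = x + - y"
    by (cases x; cases y; simp add: algebra_simps grade_add grade_mult grade_grade der_add der_mult grade_der)+
  show "x + (x + x) = 0" "0 + x = x" "- x + x = 0" "1 * x = x" "x * 1 = x" "grade (grade x) = x"
    "grade (der x) = der (grade x)"
    by (cases x; simp add: zero_ext_def one_ext_def char3 grade_grade grade_der)+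
  show "(0 :: 'a ext) \<noteq> 1"
    by (simp add: zero_ext_def one_ext_def)
  show "x * y = y * x" if "grade x = x"
  proof (cases x; cases y)
    fix a b c d assume x: "x = Ext a b" and y: "y = Ext c d"
    have "grade a = a" "grade b = - b"
      using that x by (simp_all, metis minus_minus)
    then show ?thesis
      using x y by (simp add: even_commute[of a] odd_commute[of b] add.commute)
  qed
  show "x * grade y = y * x" if "grade x = - x"
  proof (cases x; cases y)
    fix a b c d assume x: "x = Ext a b" and y: "y = Ext c d"
    have "grade a = - a" "grade b = b"
      using that x by simp_all
    then show ?thesis
      using x y odd_commute[of a] even_commute[of b] by (simp add: grade_grade add.commute)
  qed
qed

end

section \<open>Seven elements of the loop\<close>

definition embed :: "'a \<Rightarrow> 'a::diff_superring3 ext" where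
  "embed a = Ext a 0"

definition xi :: "'a::zero_neq_one ext" where
  "xi = Ext 0 1"

type_synonym 'a ext4 = "'a ext ext ext ext"
type_synonym grassmann = "grp3 ext4 ext4"

definition embed2 :: "'a \<Rightarrow> 'a::diff_superring3 ext ext" where
  "embed2 a = embed (embed a)"

definition embed4 :: "'a \<Rightarrow> 'a::diff_superring3 ext4" where
  "embed4 a = embed2 (embed2 a)"

definition xi1 :: grassmann where "xi1 = xi"
definition xi2 :: grassmann where "xi2 = embed xi"
definition xi3 :: grassmann where "xi3 = embed2 xi"
definition xi4 :: grassmann where "xi4 = embed2 (embed xi)"
definition xi5 :: grassmann where "xi5 = embed4 xi"
definition xi6 :: grassmann where "xi6 = embed4 (embed xi)"
definition xi7 :: grassmann where "xi7 = embed4 (embed2 xi)"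
definition xi8 :: grassmann where "xi8 = embed4 (embed2 (embed xi))"
definition base_u :: grassmann where "base_u = embed4 (embed4 (Grp3 0 1 0))"

definition "pt_x = (1 :: grassmann, xi1)"
definition "pt_y = (1 :: grassmann, xi2)"
definition "pt_z = (1 :: grassmann, xi3)"
definition "pt_t = (1 :: grassmann, xi4)"
definition "pt_v = (1 :: grassmann, xi5)"
definition "pt_w = (1 :: grassmann, xi6)"

text \<open>
  If the odd part were a multiple of a single generator, its product with its derivative would
  vanish; hence the two terms. Their weights \<open>0\<close> and \<open>2\<close> under \<open>der\<close> are chosen so that in the
  final value the contributions in which \<open>xi7\<close> and \<open>xi8\<close> change places do not cancel. With these
  weights \<open>der (der r) = - der r\<close> holds for the odd part \<open>r\<close>, which makes the odd part of the
  second associator vanish.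
\<close>
definition "pt_a = (base_u, xi7 + base_u * base_u * xi8)"

lemmas point_defs = pt_x_def pt_y_def pt_z_def pt_t_def pt_v_def pt_w_def pt_a_def
  xi1_def xi2_def xi3_def xi4_def xi5_def xi6_def xi7_def xi8_def base_u_def
  embed4_def embed2_def embed_def xi_def

text \<open>
  Zero coefficients are folded back to \<open>0\<close> on every level, so that a product of sparse elements
  is computed without expanding all its coefficients.
\<close>
lemma ext_arith:
  "1 + Ext a b = Ext (1 + a) b" "Ext a b + 1 = Ext (a + 1) b"
  "1 - Ext a b = Ext (1 - a) (- b)" "Ext a b - 1 = Ext (a - 1) b"
  "Ext 0 0 = 0" "Ext 1 0 = 1"
  "Ext a b = 0 \<longleftrightarrow> a = 0 \<and> b = 0" "Ext a b = 1 \<longleftrightarrow> a = 1 \<and> b = 0"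
  by (simp_all add: zero_ext_def one_ext_def)

lemma grp3_arith:
  "1 + Grp3 a b c = Grp3 (1 + a) b c" "Grp3 a b c + 1 = Grp3 (a + 1) b c"
  "1 - Grp3 a b c = Grp3 (1 - a) (- b) (- c)" "Grp3 a b c - 1 = Grp3 (a - 1) b c"
  "Grp3 0 0 0 = 0" "Grp3 1 0 0 = 1" "Grp3 a b c = 0 \<longleftrightarrow> a = 0 \<and> b = 0 \<and> c = 0"
  "grade (Grp3 a b c) = Grp3 a b c"
  by (simp_all add: zero_grp3_def one_grp3_def grade_grp3_def)

lemma two_eq_minus_one: "(2 :: 'a::diff_superring3) = - 1"
  using double_eq_minus[of "1::'a"] by simp

lemmas evaluate = point_defs ext_arith grp3_arith two_eq_minus_one numerals_3

lemma points_closed: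
  "pt_x \<in> carrier vloop" "pt_y \<in> carrier vloop" "pt_z \<in> carrier vloop" "pt_t \<in> carrier vloop"
  "pt_v \<in> carrier vloop" "pt_w \<in> carrier vloop" "pt_a \<in> carrier vloop"
  by (simp_all add: evaluate even_odd_def vmul_cube_eq)

definition word :: "('a, 'b) monoid_scheme \<Rightarrow> 'a \<Rightarrow> 'a \<Rightarrow> 'a \<Rightarrow> 'a \<Rightarrow> 'a \<Rightarrow> 'a \<Rightarrow> 'a \<Rightarrow> 'a" where
  "word L x y z t v w a =
     associator L (associator L (associator L (associator L x y a) a z) t v) a w"

text \<open>
  Each of \<open>xi1\<close>, \<dots>, \<open>xi6\<close> squares to zero, so the inverse that occurs in each loop associator
  can be replaced by the inverse of \<open>pt_a\<close>, or by \<open>1\<close> in the third one, and the values stay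
  short.
\<close>
lemma word_value:
  "word vloop pt_x pt_y pt_z pt_t pt_v pt_w pt_a =
     (1 + xi1 * xi2 * xi3 * xi4 * xi5 * xi6 * xi7 * xi8, 0)"
proof -
  interpret comm_moufang_loop_exp3 "vloop :: (grassmann \<times> grassmann) monoid"
    by (rule vloop)
  let ?u = base_u
  note closed = associator_closed points_closed
  note evaluate = evaluate vmul_def pairing_def
  define p1 where "p1 = associator vloop pt_x pt_y pt_a"
  define p2 where "p2 = associator vloop p1 pt_a pt_z"
  define p3 where "p3 = associator vloop p2 pt_t pt_v"
  have p: "p1 \<in> carrier vloop" "p2 \<in> carrier vloop" "p3 \<in> carrier vloop"
    unfolding p1_def p2_def p3_def by (intro closed)+
  have 1: "p1 = (1 - xi1 * xi2 * (1 - xi7 * xi8), xi1 * xi2 * (?u * ?u * xi7 - ?u * xi8))"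
    unfolding p1_def associator_vloop[OF points_closed(1,2,7)] by (simp add: evaluate)
  have 2: "p2 = (1 + xi1 * xi2 * xi3 * (?u * xi8 - ?u * ?u * xi7), 0)"
    unfolding p2_def associator_vloop[OF p(1) points_closed(7,3)]
    unfolding 1 by (simp add: evaluate)
  have 3: "p3 = (1 - xi1 * xi2 * xi3 * xi4 * xi5 * (?u * ?u * xi7 + ?u * xi8), 0)"
    unfolding p3_def associator_vloop[OF p(2) points_closed(4,5)]
    unfolding 2 by (simp add: evaluate)
  have "associator vloop p3 pt_a pt_w = (1 + xi1 * xi2 * xi3 * xi4 * xi5 * xi6 * xi7 * xi8, 0)"
    unfolding associator_vloop[OF p(3) points_closed(7,6)]
    unfolding 3 by (simp add: evaluate)
  then show ?thesis
    by (simp only: word_def p1_def p2_def p3_def)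
qed

section \<open>The iterated associator in free loops\<close>

lemma hom_word:
  assumes L: "comm_moufang_loop L" and M: "comm_moufang_loop M" and h: "h \<in> hom L M"
    and "x \<in> carrier L" "y \<in> carrier L" "z \<in> carrier L" "t \<in> carrier L" "v \<in> carrier L"
      "w \<in> carrier L" "a \<in> carrier L"
  shows "h (word L x y z t v w a) = word M (h x) (h y) (h z) (h t) (h v) (h w) (h a)"
proof -
  interpret L: comm_moufang_loop L by fact
  show ?thesis
    using assms(4-) by (simp add: word_def hom_associator[OF L M h] L.associator_closed)
qed

lemma free_gen_closed: "g \<in> S \<Longrightarrow> free_gen S g \<in> carrier (free_CML3 S)"
  by (simp add: free_gen_def free_carrier)

lemma word_free_neq_one:
  assumes distinct: "distinct [x, y, z, t, v, w, a]" and gens: "{x, y, z, t, v, w, a} \<subseteq> S"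
  shows "word (free_CML3 S) (free_gen S x) (free_gen S y) (free_gen S z) (free_gen S t)
    (free_gen S v) (free_gen S w) (free_gen S a) \<noteq> \<one>\<^bsub>free_CML3 S\<^esub>"
    (is "?word \<noteq> _")
proof
  assume eq: "?word = \<one>\<^bsub>free_CML3 S\<^esub>"
  let ?L = "vloop :: (grassmann \<times> grassmann) monoid"
  define f where "f = (\<lambda>g. \<one>\<^bsub>?L\<^esub>)(x := pt_x, y := pt_y, z := pt_z, t := pt_t, v := pt_v, w := pt_w,
    a := pt_a)"
  have "\<one>\<^bsub>?L\<^esub> \<in> carrier ?L"
    by simp
  then have "f g \<in> carrier ?L" for g
    using points_closed by (simp add: f_def del: vloop_simps)
  then obtain h where h: "h \<in> hom (free_CML3 S) ?L" "\<forall>g\<in>S. h (free_gen S g) = f g"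
    using free_CML3_universal[OF vloop] by metis
  have F: "comm_moufang_loop (free_CML3 S)" and L: "comm_moufang_loop ?L"
    by (rule comm_moufang_loop_exp3.axioms(1)[OF free_CML3_is_CML3]
        comm_moufang_loop_exp3.axioms(1)[OF vloop])+
  have "h ?word = word ?L (f x) (f y) (f z) (f t) (f v) (f w) (f a)"
    using gens h(2) by (simp add: hom_word[OF F L h(1)] free_gen_closed)
  also have "\<dots> = word ?L pt_x pt_y pt_z pt_t pt_v pt_w pt_a"
    using distinct by (simp add: f_def)
  finally have "(1 + xi1 * xi2 * xi3 * xi4 * xi5 * xi6 * xi7 * xi8, 0) = \<one>\<^bsub>?L\<^esub>"
    using eq hom_one[OF F L h(1)] by (simp only: word_value)
  then show False by (simp add: evaluate)
qed

lemma word_in_TAH: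
  assumes "x \<in> carrier L" "y \<in> carrier L" "z \<in> carrier L" "t \<in> carrier L" "v \<in> carrier L"
    "w \<in> carrier L" "a \<in> carrier L"
  shows "word L x y z t v w a \<in> TAH L"
proof -
  let ?p = "Assoc (Assoc (Assoc (Assoc (Arg x) (Arg y) (Arg a)) (Arg a) (Arg z)) (Arg t) (Arg v))
    (Arg a) (Arg w)"
  have "set (args ?p) \<subseteq> carrier L" "count_list (args ?p) a \<ge> 3"
    using assms by simp_all
  then have "assoc_value L ?p \<in> triple_argument_associators L"
    unfolding triple_argument_associators_def by blast
  then have "assoc_value L ?p \<in> TAH L"
    unfolding TAH_def normal_closure_def by blast
  then show ?thesis
    by (simp add: word_def)
qed

theorem mainTheorem3:
  shows "(\<forall>x y z t v w a :: 'g. distinct [x, y, z, t, v, w, a] \<longrightarrow>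
            (let F = free_CML3 {x, y, z, t, v, w, a};
                 g = free_gen {x, y, z, t, v, w, a};
                 A = associator F
             in A (A (A (A (g x) (g y) (g a)) (g a) (g z)) (g t) (g v)) (g a) (g w) \<noteq> \<one>\<^bsub>F\<^esub>))
         \<and> (\<forall>n\<ge>7. TAH (free_loop n) \<noteq> {\<one>\<^bsub>free_loop n\<^esub>})"
proof (intro conjI allI impI)
  fix x y z t v w a :: 'g
  assume "distinct [x, y, z, t, v, w, a]"
  from word_free_neq_one[OF this order_refl]
  show "let F = free_CML3 {x, y, z, t, v, w, a};
          g = free_gen {x, y, z, t, v, w, a};
          A = associator F
      in A (A (A (A (g x) (g y) (g a)) (g a) (g z)) (g t) (g v)) (g a) (g w) \<noteq> \<one>\<^bsub>F\<^esub>"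
    by (simp only: Let_def word_def not_False_eq_True)
next
  fix n :: nat
  assume "n \<ge> 7"
  then have gens: "{0, 1, 2, 3, 4, 5, 6} \<subseteq> {..<n}" by auto
  let ?g = "free_gen {..<n}"
  let ?word = "word (free_loop n) (?g 0) (?g 1) (?g 2) (?g 3) (?g 4) (?g 5) (?g 6)"
  have "?word \<noteq> \<one>\<^bsub>free_loop n\<^esub>"
    unfolding free_loop_def by (rule word_free_neq_one[OF _ gens]) simp
  moreover have "?word \<in> TAH (free_loop n)"
    unfolding free_loop_def using gens by (intro word_in_TAH free_gen_closed) auto
  ultimately show "TAH (free_loop n) \<noteq> {\<one>\<^bsub>free_loop n\<^esub>}" by auto
qed

end
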